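(* If a deterministic auction is truthful for simple value maximizers, then it is a dominant strategy for a value maximizer with value $v_i$ and ROI constraint $\gamma$ to report what it is willing to pay, $v_i'=\frac{v_i}{1+\gamma}$.
   Context: Setting. There are $n$ bidders (advertisers) and a set $\mathcal O$ of outcomes. In outcome $o\in\mathcal O$, the likelihood that the user clicks on bidder $i$'s ad is $x_i(o)$ ($i$'s allocation); when the user clicks, bidder $i$ pays a price $p_i$. Each bidder has a private value per click $v_i$ and a complete and transitive preference $\preceq_i$ over outcome-price pairs $(o,p_i)$. Auction. An auction asks bidders to report their values and specifies, for bids $\mathbf b$, an outcome $f(\mathbf b)$ and payments $p_i(\mathbf b)$. Value maximizer subject to a constraint $\mathcal C$ on pairs $(o,p_i)$: if $v_ix_i(o)>v_ix_i(o')$ and $(o,p_i)$ satisfies $\mathcal C$, then $(o,p_i)\succ_i(o',p_i')$; if $x_i(o)=x_i(o')$, $p_i<p_i'$ and $(o,p_i)$ satisfies $\mathcal C$, then $(o,p_i)\succ_i(o',p_i')$; and if $(o',p_i')$ violates $\mathcal C$, then $(o,p_i)\succeq_i(o',p_i')$. A simple value maximizer is a value maximizer subject to the constraint $p_i\le v_i$. A value maximizer with ROI (return on investment) constraint $\gamma$ is a value maximizer subject to the constraint $\frac{v_i-p_i}{p_i}\ge\gamma$ (and thus $p_i\le\frac{v_i}{1+\gamma}$). Truthful. A mechanism is truthful if reporting one's true value is a dominant strategy. The term is used loosely for either of the following. DSIC: for all $i$, $v_i$ and bids $b$, $(f(b_{-i},v_i),p_i(b_{-i},v_i))\succeq_i(f(b_{-i},b_i),p_i(b_{-i},b_i))$.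 DSIC-AE (almost everywhere): for any $i$ and $b_{-i}$, the same relation holds for all $v_i$ and deviations $b_i$, except a set of $v_i$ with measure zero. *)

theory Defs
  imports "HOL-Analysis.Analysis"
begin

text \<open>
  Bidders are the elements of a finite type \<open>'n\<close>. Outcome-price pairs have type \<open>'o \<times> real\<close>, the
  second component being the bidder's price per click. A relation \<open>R :: 'o pref\<close> is read as weak
  preference: \<open>R a b\<close> means that \<open>a\<close> is at least as good as \<open>b\<close>.
\<close>

type_synonym 'o pref = "'o \<times> real \<Rightarrow> 'o \<times> real \<Rightarrow> bool"

definition preference :: "'o pref \<Rightarrow> bool" where
  "preference R \<longleftrightarrow> (\<forall>a b. R a b \<or> R b a) \<and> transp R"

definition strictly :: "'o pref \<Rightarrow> 'o pref" where
  "strictly R a b \<longleftrightarrow> R a b \<and> \<not> R b a"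

text \<open>Here \<open>xi\<close> is the allocation function of the bidder under consideration.\<close>

definition value_maximizer ::
    "('o \<times> real \<Rightarrow> bool) \<Rightarrow> ('o \<Rightarrow> real) \<Rightarrow> real \<Rightarrow> 'o pref \<Rightarrow> bool" where
  "value_maximizer C xi v R \<longleftrightarrow>
     preference R \<and>
     (\<forall>w q w' q'. v * xi w > v * xi w' \<and> C (w, q) \<longrightarrow> strictly R (w, q) (w', q')) \<and>
     (\<forall>w q w' q'. xi w = xi w' \<and> q < q' \<and> C (w, q) \<longrightarrow> strictly R (w, q) (w', q')) \<and>
     (\<forall>w q w' q'. \<not> C (w', q') \<longrightarrow> R (w, q) (w', q'))"

definition simple_value_maximizer :: "('o \<Rightarrow> real) \<Rightarrow> real \<Rightarrow> 'o pref \<Rightarrow> bool" where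
  "simple_value_maximizer xi v R \<longleftrightarrow> value_maximizer (\<lambda>(w, q). q \<le> v) xi v R"

text \<open>
  The return \<open>(v - q) / q\<close> on the investment \<open>q\<close> is meaningful only for \<open>q > 0\<close>; a bidder who pays
  nothing (or is paid) invests nothing, and the constraint is then satisfied. The guard also keeps
  the convention \<open>a / 0 = 0\<close> from ruling out a price of zero. For \<open>v \<ge> 0\<close> and \<open>\<gamma> > - 1\<close> the
  constraint amounts to \<open>q \<le> v / (1 + \<gamma>)\<close>.
\<close>

definition roi_constraint :: "real \<Rightarrow> real \<Rightarrow> 'o \<times> real \<Rightarrow> bool" where
  "roi_constraint \<gamma> v = (\<lambda>(w, q). q > 0 \<longrightarrow> (v - q) / q \<ge> \<gamma>)"

definition roi_value_maximizer :: "real \<Rightarrow> ('o \<Rightarrow> real) \<Rightarrow> real \<Rightarrow> 'o pref \<Rightarrow> bool" where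
  "roi_value_maximizer \<gamma> xi v R \<longleftrightarrow> value_maximizer (roi_constraint \<gamma> v) xi v R"

text \<open>
  A deterministic auction consists of an outcome rule \<open>f\<close> and a payment rule \<open>p\<close>, where \<open>p b i\<close> is
  the price of bidder \<open>i\<close> under the bid profile \<open>b\<close>. Values and bids range over the nonnegative
  reals. In \<open>best_report\<close> only the bids of the other bidders in \<open>b\<close> matter.
\<close>

definition best_report ::
    "(('n \<Rightarrow> real) \<Rightarrow> 'o) \<Rightarrow> (('n \<Rightarrow> real) \<Rightarrow> 'n \<Rightarrow> real) \<Rightarrow> 'n \<Rightarrow> 'o pref \<Rightarrow>
     ('n \<Rightarrow> real) \<Rightarrow> real \<Rightarrow> bool" where
  "best_report f p i R b r \<longleftrightarrow>
     (\<forall>d\<ge>0. R (f (b(i := r)), p (b(i := r)) i) (f (b(i := d)), p (b(i := d)) i))"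

text \<open>
  A bidder type \<open>T\<close> (\<open>T v R\<close>: a bidder with value \<open>v\<close> may have the preference \<open>R\<close>) is a parameter.
  Whenever bidder \<open>i\<close> is of type \<open>T\<close>, reporting \<open>\<sigma> v\<close> at value \<open>v\<close> is a dominant strategy, for
  all values or, in the almost-everywhere variant, for all values outside a null set that may
  depend on the bids of the other bidders.
\<close>

definition dominant_strategy ::
    "(('n \<Rightarrow> real) \<Rightarrow> 'o) \<Rightarrow> (('n \<Rightarrow> real) \<Rightarrow> 'n \<Rightarrow> real) \<Rightarrow> 'n \<Rightarrow> (real \<Rightarrow> 'o pref \<Rightarrow> bool) \<Rightarrow>
     (real \<Rightarrow> real) \<Rightarrow> bool" where
  "dominant_strategy f p i T \<sigma> \<longleftrightarrow>
     (\<forall>b. (\<forall>j. 0 \<le> b j) \<longrightarrow>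
       (\<forall>v\<ge>0. \<forall>R. T v R \<longrightarrow> best_report f p i R b (\<sigma> v)))"

definition dominant_strategy_AE ::
    "(('n \<Rightarrow> real) \<Rightarrow> 'o) \<Rightarrow> (('n \<Rightarrow> real) \<Rightarrow> 'n \<Rightarrow> real) \<Rightarrow> 'n \<Rightarrow> (real \<Rightarrow> 'o pref \<Rightarrow> bool) \<Rightarrow>
     (real \<Rightarrow> real) \<Rightarrow> bool" where
  "dominant_strategy_AE f p i T \<sigma> \<longleftrightarrow>
     (\<forall>b. (\<forall>j. 0 \<le> b j) \<longrightarrow>
       (AE v in lborel. v \<ge> 0 \<longrightarrow> (\<forall>R. T v R \<longrightarrow> best_report f p i R b (\<sigma> v))))"

definition DSIC ::
    "(('n \<Rightarrow> real) \<Rightarrow> 'o) \<Rightarrow> (('n \<Rightarrow> real) \<Rightarrow> 'n \<Rightarrow> real) \<Rightarrow>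
     ('n \<Rightarrow> real \<Rightarrow> 'o pref \<Rightarrow> bool) \<Rightarrow> bool" where
  "DSIC f p T \<longleftrightarrow> (\<forall>i. dominant_strategy f p i (T i) (\<lambda>v. v))"

definition DSIC_AE ::
    "(('n \<Rightarrow> real) \<Rightarrow> 'o) \<Rightarrow> (('n \<Rightarrow> real) \<Rightarrow> 'n \<Rightarrow> real) \<Rightarrow>
     ('n \<Rightarrow> real \<Rightarrow> 'o pref \<Rightarrow> bool) \<Rightarrow> bool" where
  "DSIC_AE f p T \<longleftrightarrow> (\<forall>i. dominant_strategy_AE f p i (T i) (\<lambda>v. v))"

end

theory Submission
  imports Defs
begin

text \<open>
  The ROI constraint is the price cap \<open>q \<le> v / (1 + \<gamma>)\<close>, and rescaling the value by a positive
  factor does not change the ranking of allocations. Hence the preference of a value maximizer with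
  value \<open>v\<close> and ROI constraint \<open>\<gamma>\<close> is literally one of a simple value maximizer with value
  \<open>v / (1 + \<gamma>)\<close>, for whom truthful reporting is dominant. In the almost-everywhere variant the
  exceptional set is rescaled by \<open>1 + \<gamma>\<close> and stays null.
\<close>

text \<open>For \<open>q > 0\<close>, clear the positive denominators \<open>q\<close> and
  \<open>1 + \<gamma>\<close>. For \<open>q \<le> 0\<close> both sides hold: the left by its guard,
  the right because the cap is nonnegative.\<close>

lemma roi_constraint_iff_le:
  assumes "v \<ge> 0" and "\<gamma> > - 1"
  shows "roi_constraint \<gamma> v (w, q) \<longleftrightarrow> q \<le> v / (1 + \<gamma>)"
proof (cases "q > 0")
  case True
  with assms(2) show ?thesis
    by (simp add: roi_constraint_def field_simps)
next
  case False
  moreover have "v / (1 + \<gamma>) \<ge> 0"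
    using assms by simp
  ultimately show ?thesis
    by (simp add: roi_constraint_def)
qed

lemma roi_value_maximizer_imp_simple:
  assumes "v \<ge> 0" and "\<gamma> > - 1" and R: "roi_value_maximizer \<gamma> xi v R"
  shows "simple_value_maximizer xi (v / (1 + \<gamma>)) R"
proof -
  have C: "roi_constraint \<gamma> v = (\<lambda>(w, q). q \<le> v / (1 + \<gamma>))"
    by (simp add: fun_eq_iff roi_constraint_iff_le[OF assms(1,2)])
  \<comment> \<open>At \<open>v = 0\<close> both comparisons are false, so the equivalence needs no
    positive value.\<close>
  have "v / (1 + \<gamma>) * a > v / (1 + \<gamma>) * b \<longleftrightarrow> v * a > v * b" for a b
    using assms(2) by (simp add: divide_less_cancel)
  with R show ?thesis
    unfolding roi_value_maximizer_def simple_value_maximizer_def value_maximizer_def C by metis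
qed

text \<open>Nonzero scalings of the real line preserve null sets. \<open>P\<close> may be
  non-measurable, as it must be when it quantifies over arbitrary preferences with no regularity
  known, so the rescaling is applied to a measurable null set \<open>N\<close> covering the
  exceptions.\<close>

lemma AE_lborel_divide:
  fixes c :: real
  assumes "c \<noteq> 0" and P: "AE v in lborel. P v"
  shows "AE v in lborel. P (v / c)"
proof -
  obtain N where N: "N \<in> null_sets lborel" "{v. \<not> P v} \<subseteq> N"
    using P by (auto simp: eventually_ae_filter)
  have [measurable]: "N \<in> sets borel"
    using N(1) by auto
  have "AE v in lborel. v \<notin> N"
    using N(1) by (rule AE_not_in)
  \<comment> \<open>The quotient \<open>v / c\<close> is written as an affine map with zero
    translation to match \<open>AE_borel_affine\<close>.\<close>
  then have "AE v in lborel. 0 + 1 / c * v \<notin> N"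
    using assms(1) by (intro AE_borel_affine) auto
  then show ?thesis
    by eventually_elim (use N(2) in auto)
qed

theorem lemma1:
  fixes x :: "'n::finite \<Rightarrow> 'o \<Rightarrow> real"
    and f :: "('n \<Rightarrow> real) \<Rightarrow> 'o"
    and p :: "('n \<Rightarrow> real) \<Rightarrow> 'n \<Rightarrow> real"
    and \<gamma> :: real
    and i :: 'n
  assumes "\<forall>j w. 0 \<le> x j w \<and> x j w \<le> 1"
    and "\<gamma> > - 1"
  shows "(DSIC f p (\<lambda>j. simple_value_maximizer (x j)) \<longrightarrow>
            dominant_strategy f p i (roi_value_maximizer \<gamma> (x i)) (\<lambda>v. v / (1 + \<gamma>))) \<and>
         (DSIC_AE f p (\<lambda>j. simple_value_maximizer (x j)) \<longrightarrow>
            dominant_strategy_AE f p i (roi_value_maximizer \<gamma> (x i)) (\<lambda>v. v / (1 + \<gamma>)))"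
proof (intro conjI impI)
  have nonneg: "v / (1 + \<gamma>) \<ge> 0" if "v \<ge> 0" for v
    using that assms(2) by simp
  note simple = roi_value_maximizer_imp_simple[OF _ assms(2)]
  {
    assume "DSIC f p (\<lambda>j. simple_value_maximizer (x j))"
    with nonneg simple
    show "dominant_strategy f p i (roi_value_maximizer \<gamma> (x i)) (\<lambda>v. v / (1 + \<gamma>))"
      unfolding DSIC_def dominant_strategy_def by blast
  next
    assume DSIC_AE: "DSIC_AE f p (\<lambda>j. simple_value_maximizer (x j))"
    show "dominant_strategy_AE f p i (roi_value_maximizer \<gamma> (x i)) (\<lambda>v. v / (1 + \<gamma>))"
      unfolding dominant_strategy_AE_def
    proof (intro allI impI)
      fix b :: "'n \<Rightarrow> real"
      assume "\<forall>j. 0 \<le> b j"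
      with DSIC_AE have "AE v in lborel. v \<ge> 0 \<longrightarrow>
          (\<forall>R. simple_value_maximizer (x i) v R \<longrightarrow> best_report f p i R b v)"
        unfolding DSIC_AE_def dominant_strategy_AE_def by blast
      \<comment> \<open>Here \<open>c = 1 + \<gamma>\<close>. The guard is rescaled as well, and
        \<open>nonneg\<close> discharges it below.\<close>
      then have "AE v in lborel. v / (1 + \<gamma>) \<ge> 0 \<longrightarrow>
          (\<forall>R. simple_value_maximizer (x i) (v / (1 + \<gamma>)) R \<longrightarrow>
            best_report f p i R b (v / (1 + \<gamma>)))"
        using assms(2) by (intro AE_lborel_divide) auto
      then show "AE v in lborel. v \<ge> 0 \<longrightarrow>
          (\<forall>R. roi_value_maximizer \<gamma> (x i) v R \<longrightarrow> best_report f p i R b (v / (1 + \<gamma>)))"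
        by eventually_elim (use nonneg simple in blast)
    qed
  }
qed

end
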